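(* Let $R$ be a transit function on a finite non-empty set $V$. If $R$ satisfies $(Ch)$, $(b1)$ and $(J0)$, then the $R$-convexity $\mathcal{C}_R$ is a convex geometry.
   Context: A transit function on a finite non-empty set $V$ is a map $R:V\times V\to 2^V$ such that $u\in R(u,v)$, $R(u,v)=R(v,u)$ and $R(u,u)=\{u\}$ for all $u,v\in V$. A convexity on the finite set $V$ is a family of subsets of $V$ (called convex sets) containing $\emptyset$ and $V$ and closed under intersections; the convex hull of $A\subseteq V$ is the smallest convex set containing $A$. A set $S\subseteq V$ is $R$-convex if $R(u,v)\subseteq S$ for all $u,v\in S$; $\mathcal{C}_R$ denotes the convexity of all $R$-convex subsets of $V$. A point $k$ of a convex set $K$ is an extreme point of $K$ if $K\setminus\{k\}$ is convex. A convexity is a convex geometry if every convex set $K$ is the convex hull of the set of extreme points of $K$. Axioms on $R$: - $(Ch)$: for all $u,v,w,x,y\in V$ (not necessarily distinct), if $x\in R(u,v)$ and $y\in R(x,w)$, then $y\in R(u,w)$ or $y\in R(v,w)$ or $y\in R(u,v)$. - $(b1)$: for all $u,v,x\in V$, if $x\in R(u,v)$ and $x\neq v$, then $v\notin R(u,x)$. - $(J0)$: for all pairwise distinct $u,v,x,y\in V$, if $x\in R(u,y)$ and $y\in R(x,v)$, then $x\in R(u,v)$. *)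

theory Defs
  imports "HOL.Hull"
begin

text \<open>
  The ground set is a carrier \<open>V :: 'a set\<close>; a transit function on \<open>V\<close> is a function
  \<open>R :: 'a \<Rightarrow> 'a \<Rightarrow> 'a set\<close> of which only the values on \<open>V\<close> matter. Finiteness and
  non-emptiness of \<open>V\<close> are separate hypotheses.
\<close>

definition transit_function :: "'a set \<Rightarrow> ('a \<Rightarrow> 'a \<Rightarrow> 'a set) \<Rightarrow> bool" where
  "transit_function V R \<longleftrightarrow>
     (\<forall>u\<in>V. \<forall>v\<in>V. R u v \<subseteq> V \<and> u \<in> R u v \<and> R u v = R v u) \<and> (\<forall>u\<in>V. R u u = {u})"

definition convexity :: "'a set \<Rightarrow> 'a set set \<Rightarrow> bool" where
  "convexity V \<C> \<longleftrightarrow>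
     \<C> \<subseteq> Pow V \<and> {} \<in> \<C> \<and> V \<in> \<C> \<and> (\<forall>\<A>. \<A> \<subseteq> \<C> \<and> \<A> \<noteq> {} \<longrightarrow> \<Inter>\<A> \<in> \<C>)"

text \<open>
  The library's \<open>hull\<close> is the intersection of all members of \<open>\<C>\<close> containing \<open>A\<close>. When \<open>\<C>\<close>
  is a convexity on \<open>V\<close> and \<open>A \<subseteq> V\<close>, this is the smallest member of \<open>\<C>\<close> containing \<open>A\<close>.
\<close>

definition convex_hull :: "'a set set \<Rightarrow> 'a set \<Rightarrow> 'a set" where
  "convex_hull \<C> A = (\<lambda>S. S \<in> \<C>) hull A"

definition extreme_points :: "'a set set \<Rightarrow> 'a set \<Rightarrow> 'a set" where
  "extreme_points \<C> K = {k \<in> K. K - {k} \<in> \<C>}"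

definition convex_geometry :: "'a set \<Rightarrow> 'a set set \<Rightarrow> bool" where
  "convex_geometry V \<C> \<longleftrightarrow>
     convexity V \<C> \<and> (\<forall>K\<in>\<C>. K = convex_hull \<C> (extreme_points \<C> K))"

definition R_convex_sets :: "'a set \<Rightarrow> ('a \<Rightarrow> 'a \<Rightarrow> 'a set) \<Rightarrow> 'a set set" where
  "R_convex_sets V R = {S. S \<subseteq> V \<and> (\<forall>u\<in>S. \<forall>v\<in>S. R u v \<subseteq> S)}"

definition axiom_Ch :: "'a set \<Rightarrow> ('a \<Rightarrow> 'a \<Rightarrow> 'a set) \<Rightarrow> bool" where
  "axiom_Ch V R \<longleftrightarrow>
     (\<forall>u\<in>V. \<forall>v\<in>V. \<forall>w\<in>V. \<forall>x\<in>V. \<forall>y\<in>V.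
        x \<in> R u v \<and> y \<in> R x w \<longrightarrow> y \<in> R u w \<or> y \<in> R v w \<or> y \<in> R u v)"

definition axiom_b1 :: "'a set \<Rightarrow> ('a \<Rightarrow> 'a \<Rightarrow> 'a set) \<Rightarrow> bool" where
  "axiom_b1 V R \<longleftrightarrow>
     (\<forall>u\<in>V. \<forall>v\<in>V. \<forall>x\<in>V. x \<in> R u v \<and> x \<noteq> v \<longrightarrow> v \<notin> R u x)"

definition axiom_J0 :: "'a set \<Rightarrow> ('a \<Rightarrow> 'a \<Rightarrow> 'a set) \<Rightarrow> bool" where
  "axiom_J0 V R \<longleftrightarrow>
     (\<forall>u\<in>V. \<forall>v\<in>V. \<forall>x\<in>V. \<forall>y\<in>V.
        distinct [u, v, x, y] \<and> x \<in> R u y \<and> y \<in> R x v \<longrightarrow> x \<in> R u v)"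

end

theory Submission
  imports Defs
begin

text \<open>
  By (Ch), the convex hull of a set is the union of the transit sets of pairs of its points. Let
  \<open>C\<close> be convex and \<open>p \<noteq> q\<close> be outside \<open>C\<close>, each in the hull of \<open>C\<close> and the other. Then
  \<open>q \<in> R a p\<close> and \<open>p \<in> R b q\<close> for some \<open>a, b \<in> C\<close>, which contradicts (b1) if \<open>a = b\<close> and gives
  \<open>q \<in> R a b \<subseteq> C\<close> by (J0) otherwise. So the convexity is anti-exchange, and a maximal
  proper convex subset of \<open>K\<close> containing the extreme points of \<open>K\<close> would miss only one point
  of \<open>K\<close>, which would then be extreme.
\<close>

lemma convexity_R_convex_sets:
  assumes "transit_function V R"
  shows "convexity V (R_convex_sets V R)"
proof -
  have V: "V \<in> R_convex_sets V R"
    using assms unfolding R_convex_sets_def transit_function_def by auto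
  have "\<Inter>\<A> \<in> R_convex_sets V R" if \<A>: "\<A> \<subseteq> R_convex_sets V R" "\<A> \<noteq> {}" for \<A>
  proof -
    have S: "S \<subseteq> V" "\<And>u v. u \<in> S \<Longrightarrow> v \<in> S \<Longrightarrow> R u v \<subseteq> S" if "S \<in> \<A>" for S
      using subsetD[OF \<A>(1) that] unfolding R_convex_sets_def by simp_all
    have "\<Inter>\<A> \<subseteq> V"
      using S(1) \<A>(2) by (rule Inter_subset)
    moreover have "R u v \<subseteq> \<Inter>\<A>" if "u \<in> \<Inter>\<A>" "v \<in> \<Inter>\<A>" for u v
      using that by (intro Inter_greatest S(2)) (simp_all only: Inter_iff)
    ultimately show ?thesis unfolding R_convex_sets_def by simp
  qed
  moreover have "R_convex_sets V R \<subseteq> Pow V" "{} \<in> R_convex_sets V R"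
    unfolding R_convex_sets_def by auto
  ultimately show ?thesis
    using V unfolding convexity_def by (intro conjI allI impI) simp_all
qed

lemma convex_hull_subset: "A \<subseteq> K \<Longrightarrow> K \<in> \<C> \<Longrightarrow> convex_hull \<C> A \<subseteq> K"
  unfolding convex_hull_def by (rule hull_minimal)

lemma subset_convex_hull: "A \<subseteq> convex_hull \<C> A"
  unfolding convex_hull_def by (rule hull_subset)

lemma convex_hull_in:
  assumes "convexity V \<C>" "A \<subseteq> V"
  shows "convex_hull \<C> A \<in> \<C>"
proof -
  \<comment> \<open>\<open>V\<close> itself belongs to this family. Nonemptiness matters because
    closure under intersection is only given for nonempty families.\<close>
  have "{S. S \<in> \<C> \<and> A \<subseteq> S} \<subseteq> \<C> \<and> {S. S \<in> \<C> \<and> A \<subseteq> S} \<noteq> {}"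
    using assms unfolding convexity_def by blast
  then show ?thesis
    using assms(1) unfolding convexity_def convex_hull_def hull_def by blast
qed

text \<open>This half of the argument works for any convexity on a finite set and does not involve
  \<open>R\<close>; finiteness supplies the maximal proper convex subset.\<close>

lemma convex_geometry_if_anti_exchange:
  assumes "finite V" and conv: "convexity V \<C>"
    and anti: "\<And>C p q. C \<in> \<C> \<Longrightarrow> p \<in> V - C \<Longrightarrow> q \<in> V - C \<Longrightarrow> p \<noteq> q \<Longrightarrow>
      q \<in> convex_hull \<C> (insert p C) \<Longrightarrow> p \<notin> convex_hull \<C> (insert q C)"
  shows "convex_geometry V \<C>"
  unfolding convex_geometry_def
proof (intro conjI ballI conv)
  fix K assume K: "K \<in> \<C>"
  have sub: "S \<subseteq> V" if "S \<in> \<C>" for S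
    using conv that unfolding convexity_def by blast
  let ?H = "convex_hull \<C> (extreme_points \<C> K)"
  have ext: "extreme_points \<C> K \<subseteq> K"
    unfolding extreme_points_def by blast
  have HK: "?H \<subseteq> K"
    using ext K by (rule convex_hull_subset)
  show "K = ?H"
  proof (rule ccontr)
    assume "K \<noteq> ?H"
    let ?P = "{C \<in> \<C>. ?H \<subseteq> C \<and> C \<subset> K}"
    have "?H \<in> ?P"
      using convex_hull_in[OF conv] ext sub[OF K] HK \<open>K \<noteq> ?H\<close> by blast
    moreover have "finite ?P"
      using finite_subset[of ?P "Pow V"] sub \<open>finite V\<close> by blast
    ultimately obtain C where C: "C \<in> ?P" and max: "\<And>D. D \<in> ?P \<Longrightarrow> C \<subseteq> D \<Longrightarrow> D = C"
      using finite_has_maximal[of ?P] by (metis (no_types, lifting) empty_iff)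
    \<comment> \<open>Otherwise this hull would be a member of \<open>?P\<close> strictly larger
      than \<open>C\<close>.\<close>
    have full: "convex_hull \<C> (insert r C) = K" if "r \<in> K - C" for r
    proof (rule ccontr)
      let ?D = "convex_hull \<C> (insert r C)"
      assume "?D \<noteq> K"
      moreover have "?D \<in> \<C>"
        using that C sub[OF K] by (intro convex_hull_in[OF conv]) blast
      moreover have "?D \<subseteq> K"
        using that C K by (intro convex_hull_subset) blast+
      moreover have "insert r C \<subseteq> ?D" by (rule subset_convex_hull)
      ultimately have "?D = C" using C by (intro max) blast+
      with \<open>insert r C \<subseteq> ?D\<close> that show False by blast
    qed
    obtain p where p: "p \<in> K - C" using C by blast
    \<comment> \<open>By \<open>full\<close>, two distinct points of \<open>K - C\<close> would each
      lie in the hull of \<open>C\<close> and the other.\<close>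
    have "q = p" if q: "q \<in> K - C" for q
      using anti[of C p q] full[OF p] full[OF q] p q C sub[OF K] by blast
    then have "K - {p} = C" using p C by blast
    then have "p \<in> extreme_points \<C> K"
      using p C unfolding extreme_points_def by simp
    then have "p \<in> ?H" using subset_convex_hull by (rule rev_subsetD)
    then have "p \<in> C" using C by blast
    with p show False by blast
  qed
qed

text \<open>To see that the union is convex, take \<open>y \<in> R x w\<close> with
  \<open>x \<in> R a b\<close> and \<open>w \<in> R c d\<close>. (Ch) first trades \<open>x\<close>
  for \<open>a\<close> or \<open>b\<close>, then \<open>w\<close> for \<open>c\<close> or
  \<open>d\<close>, unless \<open>y\<close> already lies in \<open>R a b\<close> or
  \<open>R c d\<close>.\<close>

lemma R_convex_hull_eq_Union:
  assumes tr: "transit_function V R" and ch: "axiom_Ch V R" and A: "A \<subseteq> V"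
  shows "convex_hull (R_convex_sets V R) A = (\<Union>a\<in>A. \<Union>b\<in>A. R a b)" (is "_ = ?U")
proof
  have RV: "R u v \<subseteq> V" "u \<in> R u v" "R u v = R v u" if "u \<in> V" "v \<in> V" for u v
    using tr that unfolding transit_function_def by blast+
  have chD: "y \<in> R u w \<or> y \<in> R v w \<or> y \<in> R u v"
    if "x \<in> R u v" "y \<in> R x w" "u \<in> V" "v \<in> V" "w \<in> V" for u v w x y
  proof -
    have "x \<in> V" using that RV(1) by blast
    moreover from this have "y \<in> V" using that RV(1) by blast
    ultimately show ?thesis using ch that unfolding axiom_Ch_def by blast
  qed
  have "R x w \<subseteq> ?U" if "x \<in> ?U" "w \<in> ?U" for x w
  proof
    fix y assume y: "y \<in> R x w"
    obtain a b where ab: "a \<in> A" "b \<in> A" "x \<in> R a b" using \<open>x \<in> ?U\<close> by blast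
    obtain c d where cd: "c \<in> A" "d \<in> A" "w \<in> R c d" using \<open>w \<in> ?U\<close> by blast
    have "w \<in> V" using cd A RV(1) by blast
    \<comment> \<open>The second use of (Ch): symmetry moves \<open>w\<close> to the first argument,
      where it can be split into \<open>c\<close> and \<open>d\<close>.\<close>
    have step: "y \<in> ?U" if "e \<in> A" "y \<in> R e w" for e
    proof -
      have "y \<in> R w e" using that RV(3) \<open>w \<in> V\<close> A by blast
      then have "y \<in> R c e \<or> y \<in> R d e \<or> y \<in> R c d"
        using chD[OF cd(3)] cd A \<open>e \<in> A\<close> by blast
      then show ?thesis using cd \<open>e \<in> A\<close> by blast
    qed
    have "y \<in> R a w \<or> y \<in> R b w \<or> y \<in> R a b"
      using chD[OF ab(3) y] ab A \<open>w \<in> V\<close> by blast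
    then show "y \<in> ?U" using ab step by blast
  qed
  moreover have "?U \<subseteq> V" using A RV(1) by blast
  ultimately have "?U \<in> R_convex_sets V R"
    unfolding R_convex_sets_def by (intro CollectI conjI ballI)
  moreover have "A \<subseteq> ?U" using A RV(2) by blast
  ultimately show "convex_hull (R_convex_sets V R) A \<subseteq> ?U"
    by (intro convex_hull_subset)
  show "?U \<subseteq> convex_hull (R_convex_sets V R) A"
    unfolding convex_hull_def hull_def R_convex_sets_def by blast
qed

text \<open>A pair generating \<open>q\<close> cannot lie inside \<open>C\<close>, which is closed
  and misses \<open>q\<close>, nor be \<open>p\<close> twice, since \<open>R p p = {p}\<close>. So
  it is mixed.\<close>

lemma in_R_convex_hull_insert:
  assumes tr: "transit_function V R" and "axiom_Ch V R" and C: "C \<in> R_convex_sets V R"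
    and p: "p \<in> V" and q: "q \<notin> C" "q \<noteq> p"
    and "q \<in> convex_hull (R_convex_sets V R) (insert p C)"
  obtains a where "a \<in> C" "q \<in> R a p"
proof -
  have CV: "C \<subseteq> V" and cl: "\<And>a b. a \<in> C \<Longrightarrow> b \<in> C \<Longrightarrow> R a b \<subseteq> C"
    using C unfolding R_convex_sets_def by blast+
  have "insert p C \<subseteq> V" using CV p by blast
  then obtain a b where ab: "a \<in> insert p C" "b \<in> insert p C" "q \<in> R a b"
    using assms by (auto simp only: R_convex_hull_eq_Union UN_iff)
  have "R p p = {p}" "\<And>c. c \<in> C \<Longrightarrow> R p c = R c p"
    using tr p CV unfolding transit_function_def by blast+
  with ab cl q that show thesis by blast
qed

theorem theorem2p5:
  fixes V :: "'a set" and R :: "'a \<Rightarrow> 'a \<Rightarrow> 'a set"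
  assumes "finite V" and "V \<noteq> {}"
    and "transit_function V R"
    and "axiom_Ch V R" and "axiom_b1 V R" and "axiom_J0 V R"
  shows "convex_geometry V (R_convex_sets V R)"
proof (rule convex_geometry_if_anti_exchange[OF assms(1) convexity_R_convex_sets[OF assms(3)]])
  fix C p q
  assume C: "C \<in> R_convex_sets V R" and p: "p \<in> V - C" and q: "q \<in> V - C" and "p \<noteq> q"
    and qh: "q \<in> convex_hull (R_convex_sets V R) (insert p C)"
  show "p \<notin> convex_hull (R_convex_sets V R) (insert q C)"
  proof
    assume ph: "p \<in> convex_hull (R_convex_sets V R) (insert q C)"
    obtain a where a: "a \<in> C" "q \<in> R a p"
      using in_R_convex_hull_insert[OF assms(3,4) C _ _ _ qh] p q \<open>p \<noteq> q\<close> by blast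
    obtain b where b: "b \<in> C" "p \<in> R b q"
      using in_R_convex_hull_insert[OF assms(3,4) C _ _ _ ph] p q \<open>p \<noteq> q\<close> by blast
    have CV: "C \<subseteq> V" using C unfolding R_convex_sets_def by blast
    \<comment> \<open>If \<open>a = b\<close>, then \<open>q \<in> R a p\<close> and
      \<open>p \<in> R a q\<close>, which (b1) forbids.\<close>
    have "a \<noteq> b"
      using assms(5) a b p q CV \<open>p \<noteq> q\<close> unfolding axiom_b1_def by blast
    then have "distinct [a, b, q, p]" using a b p q \<open>p \<noteq> q\<close> by auto
    \<comment> \<open>Symmetry brings \<open>p\<close> into the form that (J0) needs, with
      \<open>u, v, x, y\<close> taken as \<open>a, b, q, p\<close>.\<close>
    moreover have "p \<in> R q b"
      using assms(3) b q CV unfolding transit_function_def by blast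
    ultimately have "q \<in> R a b"
      using assms(6) a b p q CV unfolding axiom_J0_def by blast
    then show False using C a b q unfolding R_convex_sets_def by blast
  qed
qed

end
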